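(* Let $J\in\mathbb{N}$ and let $\mathcal{S}_{\boldsymbol{\alpha}^{(\ell)}}$, $\ell=1,\dots,J$, be subdivision operators with finitely supported real masks $\boldsymbol{\alpha}^{(\ell)}$. Let $\{\boldsymbol{c}^{(0)};\boldsymbol{d}^{(1)},\dots,\boldsymbol{d}^{(J)}\}$ and $\{\widetilde{\boldsymbol{c}}^{(0)};\widetilde{\boldsymbol{d}}^{(1)},\dots,\widetilde{\boldsymbol{d}}^{(J)}\}$ be two arbitrary sets of pyramid data, i.e. arbitrary families of real bi-infinite sequences. Let $\boldsymbol{c}^{(J)}$ and $\widetilde{\boldsymbol{c}}^{(J)}$ be the sequences reconstructed from them, respectively, by $$\boldsymbol{c}^{(\ell)}=\mathcal{S}_{\boldsymbol{\alpha}^{(\ell)}}\boldsymbol{c}^{(\ell-1)}+\boldsymbol{d}^{(\ell)},\qquad \widetilde{\boldsymbol{c}}^{(\ell)}=\mathcal{S}_{\boldsymbol{\alpha}^{(\ell)}}\widetilde{\boldsymbol{c}}^{(\ell-1)}+\widetilde{\boldsymbol{d}}^{(\ell)},\qquad \ell=1,\dots,J.$$ Then $$\|\boldsymbol{c}^{(J)}-\widetilde{\boldsymbol{c}}^{(J)}\|_\infty\le L_J\Big(\|\boldsymbol{c}^{(0)}-\widetilde{\boldsymbol{c}}^{(0)}\|_\infty+\sum_{\ell=1}^{J}\|\boldsymbol{d}^{(\ell)}-\widetilde{\boldsymbol{d}}^{(\ell)}\|_\infty\Big),$$ where $$L_J=\max\Big\{1,\ \max_{1\le p\le q\le J}\|\mathcal{P}_{q,p}\|_\infty\Big\},\qquad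 \mathcal{P}_{q,p}=\mathcal{S}_{\boldsymbol{\alpha}^{(q)}}\mathcal{S}_{\boldsymbol{\alpha}^{(q-1)}}\cdots\mathcal{S}_{\boldsymbol{\alpha}^{(p)}}.$$ In particular, for an infinite family $\{\mathcal{S}_{\boldsymbol{\alpha}^{(k)}}\mid k\in\mathbb{N}\}$ with $L=\sup_{J\ge1}L_J<\infty$, the inequality holds with $L_J$ replaced by $L$, for every number of levels $J\ge 1$.
   Context: Sequences are real-valued and bi-infinite (indexed by $\mathbb{Z}$). For a finitely supported sequence (mask) $\boldsymbol{\alpha}$, the subdivision operator is $(\mathcal{S}_{\boldsymbol{\alpha}}\boldsymbol{c})_j=\sum_{i\in\mathbb{Z}}\alpha_{j-2i}c_i$, $j\in\mathbb{Z}$. $\mathbb{N}=\{1,2,\dots\}$. For a sequence, $\|\boldsymbol{c}\|_\infty=\sup_j|c_j|\in[0,\infty]$; for a linear operator, $\|\cdot\|_\infty$ is the operator norm induced on bounded sequences, $\|\mathcal{T}\|_\infty=\sup_{\|\boldsymbol{c}\|_\infty\le1}\|\mathcal{T}\boldsymbol{c}\|_\infty$. *)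

theory Defs
  imports "HOL-Analysis.Analysis"
begin

type_synonym biseq = "int \<Rightarrow> real"

definition finitely_supported :: "biseq \<Rightarrow> bool" where
  "finitely_supported \<alpha> \<longleftrightarrow> finite {j. \<alpha> j \<noteq> 0}"

text \<open>For a finitely supported mask only finitely many terms of the sum are nonzero,
  so it is defined for every sequence \<open>c\<close>, bounded or not.\<close>

definition subdivision :: "biseq \<Rightarrow> biseq \<Rightarrow> biseq" where
  "subdivision \<alpha> c = (\<lambda>j. \<Sum>\<^sub>\<infinity>i\<in>UNIV. \<alpha> (j - 2 * i) * c i)"

text \<open>Norms take values in \<open>[0, \<infinity>]\<close>; the norm is \<open>\<infinity>\<close> for an unbounded sequence.\<close>

definition seq_norm :: "biseq \<Rightarrow> ennreal" where
  "seq_norm c = (SUP j. ennreal \<bar>c j\<bar>)"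

definition op_norm :: "(biseq \<Rightarrow> biseq) \<Rightarrow> ennreal" where
  "op_norm T = (SUP c\<in>{c. seq_norm c \<le> 1}. seq_norm (T c))"

text \<open>The operator with index \<open>p\<close> is applied first and the one with index \<open>q\<close> last.\<close>

definition subdivision_prod :: "(nat \<Rightarrow> biseq) \<Rightarrow> nat \<Rightarrow> nat \<Rightarrow> biseq \<Rightarrow> biseq" where
  "subdivision_prod \<alpha> q p = fold (\<lambda>k. subdivision (\<alpha> k)) [p..<Suc q]"

text \<open>Only meaningful for \<open>J \<ge> 1\<close>, where the inner set is nonempty.\<close>

definition stability_const :: "(nat \<Rightarrow> biseq) \<Rightarrow> nat \<Rightarrow> ennreal" where
  "stability_const \<alpha> J =
     max 1 (Max {op_norm (subdivision_prod \<alpha> q p) | p q. 1 \<le> p \<and> p \<le> q \<and> q \<le> J})"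

text \<open>The values \<open>\<alpha> 0\<close> and \<open>d 0\<close> are never used.\<close>

primrec reconstruct :: "(nat \<Rightarrow> biseq) \<Rightarrow> biseq \<Rightarrow> (nat \<Rightarrow> biseq) \<Rightarrow> nat \<Rightarrow> biseq" where
  "reconstruct \<alpha> c0 d 0 = c0"
| "reconstruct \<alpha> c0 d (Suc l) =
     (\<lambda>j. subdivision (\<alpha> (Suc l)) (reconstruct \<alpha> c0 d l) j + d (Suc l) j)"

end

theory Submission
  imports Defs
begin

text \<open>
  Since every step of the reconstruction is affine with the same linear part for both sets of
  data, the error \<open>e\<^sub>m\<close> after \<open>m\<close> levels satisfies
  \<open>e\<^sub>m\<^sub>+\<^sub>1 = S\<^sub>m\<^sub>+\<^sub>1 e\<^sub>m + \<delta>\<^sub>m\<^sub>+\<^sub>1\<close>, where \<open>\<delta>\<close> is the difference of the details.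
  Instead of unrolling this recursion into a sum, the proof transports each \<open>e\<^sub>m\<close> to the finest
  level \<open>J\<close> with the product \<open>P\<^sub>J\<^sub>,\<^sub>m\<^sub>+\<^sub>1\<close> of the remaining operators. By linearity
  \<open>P\<^sub>J\<^sub>,\<^sub>m\<^sub>+\<^sub>2 e\<^sub>m\<^sub>+\<^sub>1 = P\<^sub>J\<^sub>,\<^sub>m\<^sub>+\<^sub>1 e\<^sub>m + P\<^sub>J\<^sub>,\<^sub>m\<^sub>+\<^sub>2 \<delta>\<^sub>m\<^sub>+\<^sub>1\<close>, so passing to the next level
  costs one more term, which is at most \<open>L\<^sub>J\<close> times the norm of \<open>\<delta>\<^sub>m\<^sub>+\<^sub>1\<close>
  (\<open>seq_norm_subdivision_prod_le\<close>). Induction on \<open>m\<close> (\<open>transported_error_le\<close>) starts from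
  \<open>P\<^sub>J\<^sub>,\<^sub>1 e\<^sub>0\<close> and ends at \<open>m = J\<close>, where nothing remains to be applied and the transported error
  is \<open>e\<^sub>J\<close> itself.

  The data may be unbounded, so norms may be infinite. The constant 1 inside \<open>L\<^sub>J\<close> then does two
  things: it covers the empty product, and it makes the bound infinite as soon as one of the norms
  is, even where a product of operators vanishes and its norm times \<open>\<infinity>\<close> would be 0.
\<close>

section \<open>The supremum norm\<close>

lemma abs_le_seq_norm: "ennreal \<bar>c j\<bar> \<le> seq_norm c"
  unfolding seq_norm_def by (rule SUP_upper) simp

lemma seq_norm_triangle: "seq_norm (\<lambda>j. c j + d j) \<le> seq_norm c + seq_norm d"
  unfolding seq_norm_def[of "\<lambda>j. c j + d j"]
proof (rule SUP_least)
  fix j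
  have "ennreal \<bar>c j + d j\<bar> \<le> ennreal (\<bar>c j\<bar> + \<bar>d j\<bar>)"
    by (intro ennreal_leI abs_triangle_ineq)
  also have "\<dots> = ennreal \<bar>c j\<bar> + ennreal \<bar>d j\<bar>"
    by simp
  also have "\<dots> \<le> seq_norm c + seq_norm d"
    by (intro add_mono abs_le_seq_norm)
  finally show "ennreal \<bar>c j + d j\<bar> \<le> seq_norm c + seq_norm d" .
qed

lemma seq_norm_scale: "seq_norm (\<lambda>j. r * c j) = ennreal \<bar>r\<bar> * seq_norm c"
  by (simp add: seq_norm_def SUP_mult_left_ennreal abs_mult ennreal_mult)

section \<open>Linear operators on sequences\<close>

definition linear_operator :: "(biseq \<Rightarrow> biseq) \<Rightarrow> bool" where
  "linear_operator T \<longleftrightarrow>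
     (\<forall>a b c d. T (\<lambda>i. a * c i + b * d i) = (\<lambda>j. a * T c j + b * T d j))"

lemma linear_operator_add:
  assumes "linear_operator T"
  shows "T (\<lambda>i. c i + d i) = (\<lambda>j. T c j + T d j)"
  using assms[unfolded linear_operator_def, rule_format, of 1 c 1 d] by simp

lemma linear_operator_diff:
  assumes "linear_operator T"
  shows "T (c - d) = T c - T d"
  using assms[unfolded linear_operator_def, rule_format, of 1 c "-1" d]
  by (simp add: fun_diff_def)

lemma linear_operator_scale:
  assumes "linear_operator T"
  shows "T (\<lambda>i. r * c i) = (\<lambda>j. r * T c j)"
  using assms[unfolded linear_operator_def, rule_format, of r c 0 c] by simp

text \<open>
  Boundedness of \<open>c\<close> cannot be dropped: a linear operator may vanish on all bounded sequences
  and still be nonzero at an unbounded one, where the right-hand side would be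
  \<open>0 * \<infinity> = 0\<close>.
\<close>

lemma seq_norm_le_op_norm:
  assumes T: "linear_operator T" and fin: "seq_norm c < \<infinity>"
  shows "seq_norm (T c) \<le> op_norm T * seq_norm c"
proof -
  obtain r where r: "0 \<le> r" "seq_norm c = ennreal r"
    using fin by (cases "seq_norm c") auto
  show ?thesis
  proof (cases "r = 0")
    case True
    have "c = (\<lambda>i. 0 * c i)"
      using abs_le_seq_norm[of c] r True by (simp add: fun_eq_iff)
    then have "T c = (\<lambda>j. 0 * T c j)"
      using linear_operator_scale[OF T, of 0 c] by simp
    then show ?thesis
      by (simp add: seq_norm_def)
  next
    case False
    define u where "u = (\<lambda>i. inverse r * c i)"
    have "seq_norm u = ennreal (inverse r) * ennreal r"
      using r by (simp add: u_def seq_norm_scale)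
    also have "\<dots> = 1"
      using r False by (simp flip: ennreal_mult)
    finally have "seq_norm (T u) \<le> op_norm T"
      unfolding op_norm_def by (intro SUP_upper) simp
    moreover have "c = (\<lambda>i. r * u i)"
      using False by (simp add: u_def fun_eq_iff)
    then have "T c = (\<lambda>j. r * T u j)"
      using linear_operator_scale[OF T, of r u] by simp
    then have "seq_norm (T c) = ennreal r * seq_norm (T u)"
      using r by (simp add: seq_norm_scale)
    ultimately show ?thesis
      using r by (simp add: mult.commute[of "op_norm T"] mult_left_mono)
  qed
qed

section \<open>Products of subdivision operators\<close>

text \<open>
  A finite mask meets each row of the operator in finitely many indices, because
  \<open>i \<mapsto> j - 2 * i\<close> is injective; hence the defining series converge for all sequences and can be
  added termwise.
\<close>

lemma linear_operator_subdivision: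
  assumes "finitely_supported \<alpha>"
  shows "linear_operator (subdivision \<alpha>)"
proof -
  have summable: "(\<lambda>i. \<alpha> (j - 2 * i) * c i) summable_on UNIV" for c j
  proof -
    have "finite ((\<lambda>i. j - 2 * i) -` {j. \<alpha> j \<noteq> 0})"
      using assms unfolding finitely_supported_def
      by (rule finite_vimageI) (simp add: inj_def)
    then have "(\<lambda>i. \<alpha> (j - 2 * i) * c i) summable_on ((\<lambda>i. j - 2 * i) -` {j. \<alpha> j \<noteq> 0})"
      by (rule summable_on_finite)
    then show ?thesis
      by (rule summable_on_cong_neutral[THEN iffD1, rotated -1]) auto
  qed
  have "subdivision \<alpha> (\<lambda>i. a * c i + b * d i) j = a * subdivision \<alpha> c j + b * subdivision \<alpha> d j"
    for a b c d j
  proof -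
    have "subdivision \<alpha> (\<lambda>i. a * c i + b * d i) j =
        (\<Sum>\<^sub>\<infinity>i. a * (\<alpha> (j - 2 * i) * c i) + b * (\<alpha> (j - 2 * i) * d i))"
      by (simp add: subdivision_def algebra_simps)
    also have "\<dots> = a * subdivision \<alpha> c j + b * subdivision \<alpha> d j"
      by (simp add: subdivision_def infsum_add infsum_cmult_right summable_on_cmult_right summable)
    finally show ?thesis .
  qed
  then show ?thesis
    by (simp add: linear_operator_def fun_eq_iff)
qed

lemma linear_operator_fold:
  assumes "\<And>k. k \<in> set ks \<Longrightarrow> linear_operator (T k)"
  shows "linear_operator (fold T ks)"
  using assms by (induction ks) (auto simp: linear_operator_def)

lemma linear_operator_subdivision_prod:
  assumes "\<And>k. k \<in> {p..q} \<Longrightarrow> finitely_supported (\<alpha> k)"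
  shows "linear_operator (subdivision_prod \<alpha> q p)"
  unfolding subdivision_prod_def
  using assms by (intro linear_operator_fold linear_operator_subdivision) auto

lemma subdivision_prod_empty: "subdivision_prod \<alpha> q (Suc q) c = c"
  by (simp add: subdivision_prod_def)

lemma subdivision_prod_step:
  assumes "p \<le> q"
  shows "subdivision_prod \<alpha> q p c = subdivision_prod \<alpha> q (Suc p) (subdivision (\<alpha> p) c)"
  using assms by (simp add: subdivision_prod_def upt_conv_Cons del: upt_Suc)

section \<open>Stability of the reconstruction\<close>

lemma one_le_stability_const: "1 \<le> stability_const \<alpha> J"
  by (simp add: stability_const_def)

lemma op_norm_le_stability_const:
  assumes "1 \<le> p" "p \<le> q" "q \<le> J"
  shows "op_norm (subdivision_prod \<alpha> q p) \<le> stability_const \<alpha> J"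
proof -
  let ?N = "{op_norm (subdivision_prod \<alpha> q p) | p q. 1 \<le> p \<and> p \<le> q \<and> q \<le> J}"
  have "?N \<subseteq> (\<lambda>(p, q). op_norm (subdivision_prod \<alpha> q p)) ` ({..J} \<times> {..J})"
    by force
  then have "finite ?N"
    by (rule finite_subset) simp
  then have "op_norm (subdivision_prod \<alpha> q p) \<le> Max ?N"
    using assms by (intro Max_ge) auto
  then show ?thesis
    by (simp add: stability_const_def max.coboundedI2)
qed

text \<open>
  The range of \<open>m\<close> includes the empty product \<open>m = J\<close>, and \<open>c\<close> may be unbounded; both
  cases rest on \<open>stability_const \<alpha> J \<ge> 1\<close>.
\<close>

lemma seq_norm_subdivision_prod_le:
  assumes fs: "\<And>l. l \<in> {1..J} \<Longrightarrow> finitely_supported (\<alpha> l)" and "m \<le> J"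
  shows "seq_norm (subdivision_prod \<alpha> J (Suc m) c) \<le> stability_const \<alpha> J * seq_norm c"
proof -
  consider "m = J" | "seq_norm c = \<infinity>" | "m < J" "seq_norm c < \<infinity>"
    using \<open>m \<le> J\<close> by (cases "m = J"; cases "seq_norm c = \<infinity>") (auto simp: less_top)
  then show ?thesis
  proof cases
    case 1
    then show ?thesis
      using mult_right_mono[OF one_le_stability_const, of "seq_norm c" \<alpha> J]
      by (simp add: subdivision_prod_empty)
  next
    case 2
    have "stability_const \<alpha> J \<noteq> 0"
      using one_le_stability_const[of \<alpha> J] by auto
    with 2 show ?thesis
      by (simp add: ennreal_mult_top)
  next
    case 3
    have "linear_operator (subdivision_prod \<alpha> J (Suc m))"
      using fs by (intro linear_operator_subdivision_prod) auto
    then have "seq_norm (subdivision_prod \<alpha> J (Suc m) c)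
        \<le> op_norm (subdivision_prod \<alpha> J (Suc m)) * seq_norm c"
      using 3 by (intro seq_norm_le_op_norm)
    also have "\<dots> \<le> stability_const \<alpha> J * seq_norm c"
      using 3 by (intro mult_right_mono op_norm_le_stability_const) auto
    finally show ?thesis .
  qed
qed

lemma reconstruct_diff_Suc:
  assumes "finitely_supported (\<alpha> (Suc m))"
  shows "reconstruct \<alpha> c0 d (Suc m) - reconstruct \<alpha> c0' d' (Suc m) =
    (\<lambda>j. subdivision (\<alpha> (Suc m)) (reconstruct \<alpha> c0 d m - reconstruct \<alpha> c0' d' m) j
         + (d (Suc m) - d' (Suc m)) j)"
  by (simp add: linear_operator_diff[OF linear_operator_subdivision[OF assms]] fun_eq_iff)

text \<open>
  The target level \<open>J\<close> stays fixed during the induction. Bounding the error at level \<open>m\<close>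
  directly would multiply the norms of the single operators, whereas only the norms of their
  products are controlled.
\<close>

lemma transported_error_le:
  assumes fs: "\<And>l. l \<in> {1..J} \<Longrightarrow> finitely_supported (\<alpha> l)" and "m \<le> J"
  shows "seq_norm (subdivision_prod \<alpha> J (Suc m) (reconstruct \<alpha> c0 d m - reconstruct \<alpha> c0' d' m))
    \<le> stability_const \<alpha> J * (seq_norm (c0 - c0') + (\<Sum>l = 1..m. seq_norm (d l - d' l)))"
  using \<open>m \<le> J\<close>
proof (induction m)
  case 0
  have "seq_norm (subdivision_prod \<alpha> J (Suc 0) (c0 - c0'))
      \<le> stability_const \<alpha> J * seq_norm (c0 - c0')"
    using fs by (intro seq_norm_subdivision_prod_le) auto
  then show ?case
    by (simp only: reconstruct.simps atLeastatMost_empty sum.empty add_0_right zero_less_one)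
next
  case (Suc m)
  let ?P = "subdivision_prod \<alpha> J" and ?L = "stability_const \<alpha> J"
  let ?e = "reconstruct \<alpha> c0 d m - reconstruct \<alpha> c0' d' m"
  let ?\<delta> = "d (Suc m) - d' (Suc m)"
  have "linear_operator (?P (Suc (Suc m)))"
    using fs by (intro linear_operator_subdivision_prod) auto
  moreover have "finitely_supported (\<alpha> (Suc m))"
    using fs Suc.prems by auto
  ultimately have "?P (Suc (Suc m)) (reconstruct \<alpha> c0 d (Suc m) - reconstruct \<alpha> c0' d' (Suc m)) =
      (\<lambda>j. ?P (Suc m) ?e j + ?P (Suc (Suc m)) ?\<delta> j)"
    using Suc.prems
    by (simp only: reconstruct_diff_Suc linear_operator_add subdivision_prod_step[of "Suc m"])
  then have "seq_norm (?P (Suc (Suc m)) (reconstruct \<alpha> c0 d (Suc m) - reconstruct \<alpha> c0' d' (Suc m)))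
      \<le> seq_norm (?P (Suc m) ?e) + seq_norm (?P (Suc (Suc m)) ?\<delta>)"
    by (simp only: seq_norm_triangle)
  also have "\<dots> \<le> ?L * (seq_norm (c0 - c0') + (\<Sum>l = 1..m. seq_norm (d l - d' l)))
      + ?L * seq_norm ?\<delta>"
    using Suc.prems by (intro add_mono Suc.IH seq_norm_subdivision_prod_le fs) auto
  also have "\<dots> = ?L * (seq_norm (c0 - c0') + (\<Sum>l = 1..Suc m. seq_norm (d l - d' l)))"
    by (simp add: distrib_left add.assoc)
  finally show ?case .
qed

lemma reconstruct_stable:
  assumes "\<And>l. l \<in> {1..J} \<Longrightarrow> finitely_supported (\<alpha> l)"
  shows "seq_norm (reconstruct \<alpha> c0 d J - reconstruct \<alpha> c0' d' J)
    \<le> stability_const \<alpha> J * (seq_norm (c0 - c0') + (\<Sum>l = 1..J. seq_norm (d l - d' l)))"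
  using transported_error_le[OF assms order_refl, where J = J] by (simp add: subdivision_prod_empty)

theorem theorem3p5:
  shows "(\<forall>(J::nat) (\<alpha> :: nat \<Rightarrow> int \<Rightarrow> real).
            J \<ge> 1 \<longrightarrow> (\<forall>l\<in>{1..J}. finitely_supported (\<alpha> l)) \<longrightarrow>
            (\<forall>c0 c0' d d'.
               seq_norm (reconstruct \<alpha> c0 d J - reconstruct \<alpha> c0' d' J)
               \<le> stability_const \<alpha> J *
                 (seq_norm (c0 - c0') + (\<Sum>l = 1..J. seq_norm (d l - d' l)))))
         \<and>
         (\<forall>(\<alpha> :: nat \<Rightarrow> int \<Rightarrow> real) L.
            (\<forall>k\<ge>1. finitely_supported (\<alpha> k)) \<longrightarrow>
            L = (SUP J\<in>{1..}. stability_const \<alpha> J) \<longrightarrow> L < \<infinity> \<longrightarrow>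
            (\<forall>J\<ge>1. \<forall>c0 c0' d d'.
               seq_norm (reconstruct \<alpha> c0 d J - reconstruct \<alpha> c0' d' J)
               \<le> L * (seq_norm (c0 - c0') + (\<Sum>l = 1..J. seq_norm (d l - d' l)))))"
proof (intro conjI allI impI)
  fix J :: nat and \<alpha> :: "nat \<Rightarrow> int \<Rightarrow> real" and c0 c0' d d'
  assume "\<forall>l\<in>{1..J}. finitely_supported (\<alpha> l)"
  then show "seq_norm (reconstruct \<alpha> c0 d J - reconstruct \<alpha> c0' d' J)
      \<le> stability_const \<alpha> J * (seq_norm (c0 - c0') + (\<Sum>l = 1..J. seq_norm (d l - d' l)))"
    by (intro reconstruct_stable) auto
next
  fix \<alpha> :: "nat \<Rightarrow> int \<Rightarrow> real" and L and J :: nat and c0 c0' d d'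
  assume fs: "\<forall>k\<ge>1. finitely_supported (\<alpha> k)"
    and L: "L = (SUP J\<in>{1..}. stability_const \<alpha> J)" and "J \<ge> 1"
  have "seq_norm (reconstruct \<alpha> c0 d J - reconstruct \<alpha> c0' d' J)
      \<le> stability_const \<alpha> J * (seq_norm (c0 - c0') + (\<Sum>l = 1..J. seq_norm (d l - d' l)))"
    using fs by (intro reconstruct_stable) auto
  also have "\<dots> \<le> L * (seq_norm (c0 - c0') + (\<Sum>l = 1..J. seq_norm (d l - d' l)))"
    unfolding L using \<open>J \<ge> 1\<close> by (intro mult_right_mono SUP_upper) auto
  finally show "seq_norm (reconstruct \<alpha> c0 d J - reconstruct \<alpha> c0' d' J)
      \<le> L * (seq_norm (c0 - c0') + (\<Sum>l = 1..J. seq_norm (d l - d' l)))" .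
qed

end
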